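(* Let $L_1,L_2\in(0,\infty]$ and $\mu_1,\mu_2\in[0,\infty)$ with $L_1>\mu_2$ and $L_2>\mu_1$. Let $f_1\in\mathcal{F}_{\mu_1,L_1}(\mathbb{R}^n)$, $f_2\in\mathcal{F}_{\mu_2,L_2}(\mathbb{R}^n)$, let $f=f_1-f_2$ be lower semicontinuous and bounded below, and let $f^\star\in\mathbb{R}$ be a lower bound of $f$ on $\mathbb{R}^n$. Let $N\ge1$ and let $x^1,\dots,x^{N+1}$ together with $g_1^k\in\partial f_1(x^k)$ and $g_2^k\in\partial f_2(x^k)$ ($1\le k\le N+1$) be generated by $N$ iterations of the DCA started at $x^1$. Then: (i) If $L_1=\infty$ and $L_2<\infty$, then $$\min_{1\leq k\leq N+1}\left\|g_1^k-g_2^k\right\|\leq \sqrt{\frac{2L_2^2\left( f(x^1)-f^\star \right)}{N(L_2+\mu_1)}}.$$ (ii) If $L_2=\infty$ and $L_1<\infty$, then $$\min_{1\leq k\leq N+1}\left\|g_1^k-g_2^k\right\|\leq \sqrt{\frac{2L_1^2\left(L_1-\mu_2\right)\left( f(x^1)-f^\star \right)}{\left(L_1^2-\mu_2^2\right)N+L_1^2}}.$$ (iii) If $L_1,L_2<\infty$ and $\mu_1=\mu_2=0$, then $$\min_{1\leq k\leq N+1}\left\|g_1^k-g_2^k\right\|\leq \sqrt{\frac{2L_1L_2\left(f(x^1)-f^\star\right)}{\left(L_1+L_2\right)N+L_2}}.$$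
   Context: $\|\cdot\|$ and $\langle\cdot,\cdot\rangle$ are the Euclidean norm and inner product on $\mathbb{R}^n$. For an extended-valued convex function $h$, $\partial h(x)=\{g: h(y)\ge h(x)+\langle g,y-x\rangle\ \forall y\in\mathbb{R}^n\}$ for $x$ with $h(x)<\infty$. For $L\in(0,\infty]$, $h$ is $L$-smooth if $\|g_1-g_2\|\le L\|x_1-x_2\|$ for all $x_1,x_2\in\mathbb{R}^n$, $g_1\in\partial h(x_1)$, $g_2\in\partial h(x_2)$ (if $L<\infty$ then $h$ is finite and differentiable on $\mathbb{R}^n$; every convex function is $\infty$-smooth). For $\mu\ge0$, $h$ is $\mu$-strongly convex if $x\mapsto h(x)-\frac{\mu}{2}\|x\|^2$ is convex. $\mathcal{F}_{\mu,L}(\mathbb{R}^n)$ is the set of closed proper convex functions $h:\mathbb{R}^n\to(-\infty,\infty]$ that are $L$-smooth and $\mu$-strongly convex. The difference $f_1-f_2$ is taken to be $+\infty$ wherever $f_1=+\infty$. DCA (Difference-of-Convex Algorithm): starting from $x^1\in\mathbb{R}^n$, for $k=1,2,\dots$ choose $g_2^k\in\partial f_2(x^k)$ and then choose $x^{k+1}\in\operatorname{argmin}_{x\in\mathbb{R}^n}\, f_1(x)-f_2(x^k)-\langle g_2^k,x-x^k\rangle$. It is assumed that the iterates exist and that $\partial f_1(x^k)\neq\emptyset$ and $\partial f_2(x^k)\ne\emptyset$ for all $k$. The subgradients of $f_1$ associated with the run are: $g_1^1\in\partial f_1(x^1)$ arbitrary, and $g_1^{k+1}:=g_2^k\in\partial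 f_1(x^{k+1})$ for $1\le k\le N$ (which holds by optimality of $x^{k+1}$); $g_2^{N+1}\in\partial f_2(x^{N+1})$ is arbitrary. *)

theory Defs
  imports "HOL-Analysis.Analysis"
begin

text \<open>Extended-valued functions take values in \<^typ>\<open>ereal\<close>. The library notions \<^const>\<open>epigraph\<close> and
  \<^const>\<open>convex_on\<close> only cover real-valued functions, hence the following versions.\<close>

definition ereal_epigraph :: "('a \<Rightarrow> ereal) \<Rightarrow> ('a \<times> real) set"
  where "ereal_epigraph h = {(x, t). h x \<le> ereal t}"

definition ereal_convex :: "('a::real_vector \<Rightarrow> ereal) \<Rightarrow> bool"
  where "ereal_convex h \<longleftrightarrow> convex (ereal_epigraph h)"

definition closed_fun :: "('a::topological_space \<Rightarrow> ereal) \<Rightarrow> bool"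
  where "closed_fun h \<longleftrightarrow> closed (ereal_epigraph h)"

definition proper_fun :: "('a \<Rightarrow> ereal) \<Rightarrow> bool"
  where "proper_fun h \<longleftrightarrow> (\<forall>x. h x \<noteq> -\<infinity>) \<and> (\<exists>x. h x \<noteq> \<infinity>)"

definition lower_semicontinuous :: "('a::topological_space \<Rightarrow> ereal) \<Rightarrow> bool"
  where "lower_semicontinuous h \<longleftrightarrow> (\<forall>x. h x \<le> Liminf (at x) h)"

definition subdifferential :: "('a::real_inner \<Rightarrow> ereal) \<Rightarrow> 'a \<Rightarrow> 'a set"
  where "subdifferential h x =
    {g. h x < \<infinity> \<and> (\<forall>y. h y \<ge> h x + ereal (g \<bullet> (y - x)))}"

text \<open>The case \<open>L = \<infinity>\<close> is separated because \<open>\<infinity> * 0 = 0\<close> in \<^typ>\<open>ereal\<close>: the inequality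
  \<open>norm (g1 - g2) \<le> L * norm (x1 - x2)\<close> would still force subdifferentials to have at most one
  element, whereas every convex function is to be \<open>\<infinity>\<close>-smooth.\<close>

definition smooth_fun :: "ereal \<Rightarrow> ('a::real_inner \<Rightarrow> ereal) \<Rightarrow> bool"
  where "smooth_fun L h \<longleftrightarrow> L = \<infinity> \<or>
    (\<forall>x1 x2. \<forall>g1 \<in> subdifferential h x1. \<forall>g2 \<in> subdifferential h x2.
       ereal (norm (g1 - g2)) \<le> L * ereal (norm (x1 - x2)))"

definition strongly_convex :: "real \<Rightarrow> ('a::real_inner \<Rightarrow> ereal) \<Rightarrow> bool"
  where "strongly_convex \<mu> h \<longleftrightarrow> ereal_convex (\<lambda>x. h x - ereal (\<mu> / 2 * (norm x)\<^sup>2))"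

definition F_class :: "real \<Rightarrow> ereal \<Rightarrow> ('a::real_inner \<Rightarrow> ereal) set"
  where "F_class \<mu> L = {h. closed_fun h \<and> proper_fun h \<and> ereal_convex h \<and>
    smooth_fun L h \<and> strongly_convex \<mu> h}"

definition dc_diff :: "('a \<Rightarrow> ereal) \<Rightarrow> ('a \<Rightarrow> ereal) \<Rightarrow> 'a \<Rightarrow> ereal"
  where "dc_diff f1 f2 x = (if f1 x = \<infinity> then \<infinity> else f1 x - f2 x)"

text \<open>\<open>N\<close> iterations of the DCA, indexed from 1. The sequences are constrained only at the indices
  \<open>1, \<dots>, N + 1\<close>. That \<open>g1 (k + 1)\<close> is a subgradient of \<open>f1\<close> at \<open>x (k + 1)\<close> is not required but
  derived below.\<close>

definition dca_run ::
  "('a::real_inner \<Rightarrow> ereal) \<Rightarrow> ('a \<Rightarrow> ereal) \<Rightarrow> nat \<Rightarrow>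
    (nat \<Rightarrow> 'a) \<Rightarrow> (nat \<Rightarrow> 'a) \<Rightarrow> (nat \<Rightarrow> 'a) \<Rightarrow> bool"
  where "dca_run f1 f2 N x g1 g2 \<longleftrightarrow>
    g1 1 \<in> subdifferential f1 (x 1) \<and>
    (\<forall>k\<in>{1..N}.
       g2 k \<in> subdifferential f2 (x k) \<and>
       is_arg_min (\<lambda>y. f1 y - f2 (x k) - ereal (g2 k \<bullet> (y - x k))) (\<lambda>_. True) (x (k + 1)) \<and>
       g1 (k + 1) = g2 k) \<and>
    g2 (N + 1) \<in> subdifferential f2 (x (N + 1))"

lemma dca_run_subdifferential:
  assumes run: "dca_run f1 f2 N x g1 g2" and f1: "proper_fun f1" and f2: "proper_fun f2"
    and k: "k \<in> {1..N + 1}"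
  shows "g1 k \<in> subdifferential f1 (x k)" "g2 k \<in> subdifferential f2 (x k)"
proof -
  show "g2 k \<in> subdifferential f2 (x k)"
    using run k by (cases "k = N + 1") (auto simp: dca_run_def)
  show "g1 k \<in> subdifferential f1 (x k)"
  proof (cases "k = 1")
    case True
    then show ?thesis using run by (simp add: dca_run_def)
  next
    case False
    define j where "j = k - 1"
    have j: "j \<in> {1..N}" and kj: "k = j + 1" using k False by (auto simp: j_def)
    have g: "g1 k = g2 j" and s2: "g2 j \<in> subdifferential f2 (x j)"
      and min: "\<And>y. f1 (x k) - f2 (x j) - ereal (g2 j \<bullet> (x k - x j))
                 \<le> f1 y - f2 (x j) - ereal (g2 j \<bullet> (y - x j))"
      using run j by (auto simp: dca_run_def is_arg_min_linorder kj)
    obtain c where c: "f2 (x j) = ereal c"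
      using s2 f2 by (cases "f2 (x j)") (auto simp: subdifferential_def proper_fun_def)
    obtain z where z: "f1 z \<noteq> \<infinity>" using f1 by (auto simp: proper_fun_def)
    have nm: "f1 y \<noteq> -\<infinity>" for y using f1 by (auto simp: proper_fun_def)
    obtain a where a: "f1 (x k) = ereal a"
      using min[of z] z nm[of z] nm[of "x k"] c by (cases "f1 (x k)"; cases "f1 z") auto
    have "f1 y \<ge> f1 (x k) + ereal (g2 j \<bullet> (y - x k))" for y
      using min[of y] nm[of y] a c by (cases "f1 y") (auto simp: inner_diff_right)
    then show ?thesis by (simp add: subdifferential_def g a)
  qed
qed

end

theory Submission
  imports Defs
begin

text \<open>
  Write \<open>d k = norm (g1 k - g2 k)\<close> and \<open>f = f1 - f2\<close>. Each bound comes from a lower bound, by multiples of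
  the \<open>(d k)\<^sup>2\<close>, on the decrease \<open>f (x k) - f (x (k + 1))\<close>, summed over the run.

  The link between consecutive iterates is that \<open>s = g2 k = g1 (k + 1)\<close> is a subgradient of \<open>f2\<close> at the old
  point and of \<open>f1\<close> at the new one. Hence the subgradient inequality of \<open>f1\<close> at \<open>x (k + 1)\<close>, evaluated at
  \<open>x k\<close>, and that of \<open>f2\<close> at \<open>x k\<close>, evaluated at \<open>x (k + 1)\<close>, have the same linear term up to sign. In
  their sum it cancels, and the decrease is at least the sum of the two excesses over the linear
  minorants. Strong convexity makes such an excess at least \<open>\<mu> / 2\<close> times the squared step length
  (\<open>strongly_convex_excess\<close>). \<open>L\<close>-smoothness makes it at least \<open>1 / (2 L)\<close> times the squared
  distance of the subgradients at the two points (\<open>smooth_fun_excess\<close>). This distance is \<open>d k\<close> for \<open>f1\<close> and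
  \<open>d (k + 1)\<close> for \<open>f2\<close>, and by \<open>L\<close>-smoothness it bounds the step length from below, so that both kinds
  of excess are measured by \<open>d\<close>. When \<open>f1\<close> is smooth, one more term is gained at the last iterate:
  there \<open>f\<close> lies below a quadratic of curvature \<open>L1 - \<mu>2\<close> with slope \<open>g1 - g2\<close>, whose minimum
  is still at least the lower bound of \<open>f\<close> (\<open>subgradient_gap_le_optimality_gap\<close>).

  The analytic core is that an \<open>L\<close>-smooth function lies below the quadratics of curvature \<open>L\<close>
  that touch it (\<open>smooth_fun_descent\<close>). Smoothness is only a condition on pairs of existing subgradients,
  so that subgradients must first be produced at every point (\<open>smooth_fun_has_subgradient\<close>); in particular the
  function is finite everywhere. They are found through the proximal map, which exists by compactness.
\<close>

section \<open>Subgradients\<close>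

lemma le_if_le_plus_inverse_nat:
  fixes A B C :: real
  assumes "\<And>n::nat. 0 < n \<Longrightarrow> A \<le> B + C / real n"
  shows "A \<le> B"
proof -
  have "(\<lambda>n. B + C * (1 / real n)) \<longlonglongrightarrow> B + C * 0"
    by (intro tendsto_intros lim_1_over_n)
  then have lim: "(\<lambda>n. B + C / real n) \<longlonglongrightarrow> B"
    by simp
  show ?thesis
    by (rule LIMSEQ_le_const[OF lim]) (use assms in \<open>auto intro!: exI[of _ 1]\<close>)
qed

lemma subgradient_finite:
  assumes "proper_fun h" "g \<in> subdifferential h x"
  shows "h x = ereal (real_of_ereal (h x))"
  using assms by (cases "h x") (auto simp: subdifferential_def proper_fun_def)

lemma subdifferentialD:
  assumes "g \<in> subdifferential h x"
  shows "h x + ereal (g \<bullet> (y - x)) \<le> h y"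
  using assms by (simp add: subdifferential_def)

lemma subdifferential_monotone:
  assumes h: "proper_fun h" and g: "g \<in> subdifferential h x" and g': "g' \<in> subdifferential h x'"
  shows "0 \<le> (g - g') \<bullet> (x - x')"
proof -
  obtain a a' where "h x = ereal a" "h x' = ereal a'"
    using subgradient_finite[OF h g] subgradient_finite[OF h g'] by blast
  then show ?thesis
    using subdifferentialD[OF g, of x'] subdifferentialD[OF g', of x]
    by (simp add: inner_diff_left inner_diff_right)
qed

lemma ereal_convexD:
  assumes "ereal_convex h" "h x \<le> ereal a" "h y \<le> ereal b" "0 \<le> t" "t \<le> 1"
  shows "h (x + t *\<^sub>R (y - x)) \<le> ereal ((1 - t) * a + t * b)"
proof -
  have "(1 - t) *\<^sub>R (x, a) + t *\<^sub>R (y, b) \<in> ereal_epigraph h"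
    using assms by (intro convexD) (auto simp: ereal_convex_def ereal_epigraph_def)
  then show ?thesis
    by (simp add: ereal_epigraph_def algebra_simps)
qed

text \<open>Compare the chord inequality of \<open>h - \<mu> / 2 * norm\<^sup>2\<close> at \<open>x + t * (y - x)\<close> with the subgradient
  inequality of \<open>h\<close> there, divide by \<open>t\<close> and let \<open>t\<close> tend to \<open>0\<close>.\<close>

lemma strongly_convex_excess:
  fixes h :: "'a::real_inner \<Rightarrow> ereal"
  assumes h: "proper_fun h" "strongly_convex \<mu> h" and g: "g \<in> subdifferential h x"
  shows "h x + ereal (g \<bullet> (y - x) + \<mu> / 2 * (norm (y - x))\<^sup>2) \<le> h y"
proof (cases "h y")
  case (real b)
  obtain a where a: "h x = ereal a"
    using subgradient_finite[OF h(1) g] by blast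
  define d where "d = y - x"
  have "a + g \<bullet> d + \<mu> / 2 * (norm d)\<^sup>2 \<le> b + (\<mu> / 2 * (norm d)\<^sup>2) / real n" if "0 < n" for n :: nat
  proof -
    define t where "t = 1 / real n"
    have t: "0 < t" "t \<le> 1"
      using that by (auto simp: t_def)
    define z where "z = x + t *\<^sub>R d"
    have conv: "ereal_convex (\<lambda>x. h x - ereal (\<mu> / 2 * (norm x)\<^sup>2))"
      using h(2) by (simp add: strongly_convex_def)
    have up: "h z - ereal (\<mu> / 2 * (norm z)\<^sup>2)
        \<le> ereal ((1 - t) * (a - \<mu> / 2 * (norm x)\<^sup>2) + t * (b - \<mu> / 2 * (norm y)\<^sup>2))"
      using ereal_convexD[OF conv, of x _ y _ t] t a real by (simp add: z_def d_def)
    have low: "ereal (a + t * (g \<bullet> d)) \<le> h z"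
      using subdifferentialD[OF g, of z] a by (simp add: z_def)
    obtain c where c: "h z = ereal c"
      using up low by (cases "h z") auto
    have norm_z: "(norm z)\<^sup>2 = (1 - t) * (norm x)\<^sup>2 + t * (norm y)\<^sup>2 - t * (1 - t) * (norm d)\<^sup>2"
      unfolding z_def d_def power2_norm_eq_inner
      by (simp add: inner_add_left inner_add_right inner_diff_left inner_diff_right inner_commute
          algebra_simps)
    have "a + t * (g \<bullet> d) - \<mu> / 2 * (norm z)\<^sup>2
        \<le> (1 - t) * (a - \<mu> / 2 * (norm x)\<^sup>2) + t * (b - \<mu> / 2 * (norm y)\<^sup>2)"
      using up low c by simp
    then have "t * (a + g \<bullet> d + \<mu> / 2 * (norm d)\<^sup>2) \<le> t * (b + \<mu> / 2 * (norm d)\<^sup>2 * t)"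
      unfolding norm_z by (simp add: field_simps)
    then show ?thesis
      unfolding mult_le_cancel_left_pos[OF t(1)] by (simp add: t_def)
  qed
  then have "a + g \<bullet> d + \<mu> / 2 * (norm d)\<^sup>2 \<le> b"
    by (rule le_if_le_plus_inverse_nat)
  then show ?thesis
    by (simp add: a real d_def add.assoc)
next
  case PInf
  then show ?thesis by simp
next
  case MInf
  then show ?thesis using h by (simp add: proper_fun_def)
qed

section \<open>Smooth functions have subgradients everywhere\<close>

text \<open>The proximal point of \<open>w\<close>: the minimiser \<open>p\<close> of \<open>h u + (norm (u - w))\<^sup>2 / (2 * c)\<close>. It exists
  because the affine minorant at \<open>x0\<close> makes the objective coercive; minimising over the closed epigraph
  turns the objective into a continuous function. The inclusion is its optimality condition.\<close>

lemma proximal_point_exists: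
  fixes h :: "'a::euclidean_space \<Rightarrow> ereal"
  assumes closed: "closed_fun h" and h: "proper_fun h" and conv: "ereal_convex h"
    and g: "g \<in> subdifferential h x0" and c: "0 < c"
  shows "\<exists>p. (w - p) /\<^sub>R c \<in> subdifferential h p"
proof -
  obtain a where a: "h x0 = ereal a"
    using subgradient_finite[OF h g] by blast
  define \<phi> where "\<phi> = (\<lambda>v. snd v + (norm (fst v - w))\<^sup>2 / (2 * c))"
  define K where "K = ereal_epigraph h \<inter> {v. \<phi> v \<le> \<phi> (x0, a)}"
  have cont: "continuous_on S \<phi>" for S
    unfolding \<phi>_def using c by (intro continuous_intros) auto
  have "closed {v. \<phi> v \<le> \<phi> (x0, a)}"
    using cont by (intro closed_Collect_le) (auto intro: continuous_intros)
  then have "closed K"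
    using closed by (auto simp: K_def closed_fun_def)
  \<comment> \<open>At distance \<open>r\<close> from \<open>w\<close>, the affine minorant gives \<open>r\<^sup>2 \<le> A * r + B\<close> for the points of \<open>K\<close>,
    hence \<open>r \<le> R\<close>.\<close>
  define A where "A = 2 * c * norm g"
  define B where "B = \<bar>2 * c * (\<phi> (x0, a) - a - g \<bullet> (w - x0))\<bar>"
  define R where "R = A + B + 1"
  have "A \<ge> 0" "B \<ge> 0"
    using c by (auto simp: A_def B_def)
  have K_bound: "u \<in> cball w R \<and> t \<in> {a + g \<bullet> (w - x0) - norm g * R .. \<phi> (x0, a)}"
    if "(u, t) \<in> K" for u t
  proof -
    define r where "r = norm (u - w)"
    have ut: "t + r\<^sup>2 / (2 * c) \<le> \<phi> (x0, a)" and "h u \<le> ereal t"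
      using that by (auto simp: K_def ereal_epigraph_def \<phi>_def r_def)
    moreover have "ereal (a + g \<bullet> (u - x0)) \<le> h u"
      using subdifferentialD[OF g, of u] a by simp
    ultimately have "ereal (a + g \<bullet> (u - x0)) \<le> ereal t"
      by (meson order_trans)
    moreover have "g \<bullet> (u - x0) = g \<bullet> (w - x0) + g \<bullet> (u - w)"
      by (simp add: inner_diff_right)
    moreover have "- (norm g * r) \<le> g \<bullet> (u - w)"
      using Cauchy_Schwarz_ineq2[of g "u - w"] by (simp add: r_def abs_le_iff)
    ultimately have t: "a + g \<bullet> (w - x0) - norm g * r \<le> t"
      by simp
    then have "r\<^sup>2 / (2 * c) \<le> (\<phi> (x0, a) - a - g \<bullet> (w - x0)) + norm g * r"
      using ut by linarith
    then have "r\<^sup>2 \<le> 2 * c * (\<phi> (x0, a) - a - g \<bullet> (w - x0)) + A * r"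
      using c by (simp add: A_def field_simps)
    then have r2: "r\<^sup>2 \<le> B + A * r"
      by (simp add: B_def)
    have "r \<le> R"
    proof (rule ccontr)
      assume "\<not> r \<le> R"
      then have r: "A + B + 1 < r" by (simp add: R_def)
      then have "(A + B + 1) * r < r * r" and "B * 1 \<le> B * r"
        using \<open>A \<ge> 0\<close> \<open>B \<ge> 0\<close> by (intro mult_strict_right_mono mult_left_mono; simp)+
      then show False
        using r2 r \<open>A \<ge> 0\<close> \<open>B \<ge> 0\<close> by (simp add: power2_eq_square algebra_simps)
    qed
    moreover have "norm g * r \<le> norm g * R"
      using \<open>r \<le> R\<close> by (intro mult_left_mono) auto
    moreover have "0 \<le> r\<^sup>2 / (2 * c)"
      using c by simp
    ultimately show ?thesis
      using t ut by (auto simp: r_def dist_norm norm_minus_commute)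
  qed
  have "K \<subseteq> cball w R \<times> {a + g \<bullet> (w - x0) - norm g * R .. \<phi> (x0, a)}"
    using K_bound by auto
  then have "bounded K"
    by (rule bounded_subset[rotated]) (intro bounded_Times bounded_cball bounded_closed_interval)
  with \<open>closed K\<close> have "compact K"
    by (simp add: compact_eq_bounded_closed)
  moreover have "(x0, a) \<in> K"
    using a by (simp add: K_def ereal_epigraph_def)
  ultimately obtain v where v: "v \<in> K" "\<And>v'. v' \<in> K \<Longrightarrow> \<phi> v \<le> \<phi> v'"
    using continuous_attains_inf[of K \<phi>] cont by blast
  have min: "\<phi> v \<le> \<phi> v'" if "v' \<in> ereal_epigraph h" for v'
    using v that by (cases "\<phi> v' \<le> \<phi> (x0, a)") (auto simp: K_def)
  obtain p s where ps: "v = (p, s)" by (cases v)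
  have hp: "h p \<le> ereal s"
    using v(1) by (simp add: K_def ereal_epigraph_def ps)
  have "h p + ereal (((w - p) /\<^sub>R c) \<bullet> (y - p)) \<le> h y" for y
  proof (cases "h y")
    case (real b)
    define d where "d = y - p"
    have "s + (w - p) \<bullet> d / c \<le> b + ((norm d)\<^sup>2 / (2 * c)) / real n" if "0 < n" for n :: nat
    proof -
      define t where "t = 1 / real n"
      have t: "0 < t" "t \<le> 1"
        using that by (auto simp: t_def)
      have "h (p + t *\<^sub>R d) \<le> ereal ((1 - t) * s + t * b)"
        unfolding d_def using t hp real by (intro ereal_convexD[OF conv]) auto
      then have le: "\<phi> (p, s) \<le> \<phi> (p + t *\<^sub>R d, (1 - t) * s + t * b)"
        using min by (simp add: ps ereal_epigraph_def)
      have norm_sq: "(norm (p + t *\<^sub>R d - w))\<^sup>2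
          = (norm (p - w))\<^sup>2 - 2 * t * ((w - p) \<bullet> d) + t\<^sup>2 * (norm d)\<^sup>2"
        unfolding power2_norm_eq_inner
        by (simp add: inner_add_left inner_add_right inner_diff_left inner_diff_right inner_commute
            power2_eq_square algebra_simps)
      have "(norm (p + t *\<^sub>R d - w))\<^sup>2 / (2 * c)
          = (norm (p - w))\<^sup>2 / (2 * c) - t * ((w - p) \<bullet> d / c) + t * (t * ((norm d)\<^sup>2 / (2 * c)))"
        unfolding norm_sq using c by (simp add: field_simps power2_eq_square)
      then have "t * (s + (w - p) \<bullet> d / c) \<le> t * (b + t * ((norm d)\<^sup>2 / (2 * c)))"
        using le unfolding \<phi>_def fst_conv snd_conv by (simp add: algebra_simps)
      then show ?thesis
        unfolding mult_le_cancel_left_pos[OF t(1)] by (simp add: t_def mult.commute)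
    qed
    then have "s + (w - p) \<bullet> d / c \<le> b"
      by (rule le_if_le_plus_inverse_nat)
    then have "ereal s + ereal (((w - p) /\<^sub>R c) \<bullet> (y - p)) \<le> h y"
      by (simp add: real d_def divide_inverse mult.commute)
    then show ?thesis
      using hp by (meson add_right_mono order_trans)
  next
    case PInf
    then show ?thesis by simp
  next
    case MInf
    then show ?thesis using h by (simp add: proper_fun_def)
  qed
  moreover have "h p < \<infinity>"
    using hp by (cases "h p") auto
  ultimately show ?thesis
    by (auto simp: subdifferential_def)
qed

lemma smooth_funD:
  assumes "smooth_fun (ereal L) h" "g \<in> subdifferential h x" "g' \<in> subdifferential h x'"
  shows "norm (g - g') \<le> L * norm (x - x')"
  using assms by (auto simp: smooth_fun_def)

text \<open>The given \<open>z\<close> has to be hit as a proximal point. Let \<open>p w\<close> be the proximal point of \<open>w\<close> with parameter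
  \<open>c\<close> and \<open>q w = (w - p w) / c\<close> the subgradient at \<open>p w\<close>. As \<open>p\<close> is nonexpansive, smoothness
  makes \<open>q\<close> an \<open>L\<close>-Lipschitz map, so that \<open>w \<mapsto> z + c * q w\<close> is a contraction if \<open>c * L < 1\<close>. At its
  fixed point, \<open>p w = z\<close>.\<close>

lemma smooth_fun_has_subgradient:
  fixes h :: "'a::euclidean_space \<Rightarrow> ereal"
  assumes closed: "closed_fun h" and h: "proper_fun h" and conv: "ereal_convex h"
    and smooth: "smooth_fun (ereal L) h" and L: "0 < L" and g: "g \<in> subdifferential h x0"
  shows "\<exists>q. q \<in> subdifferential h z"
proof -
  define c where "c = 1 / (2 * L)"
  have c: "0 < c" using L by (simp add: c_def)
  obtain p where p: "\<And>w. (w - p w) /\<^sub>R c \<in> subdifferential h (p w)"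
    using proximal_point_exists[OF closed h conv g c] by metis
  define q where "q = (\<lambda>w. (w - p w) /\<^sub>R c)"
  have q: "q w \<in> subdifferential h (p w)" for w
    using p by (simp add: q_def)
  have w_eq: "w = p w + c *\<^sub>R q w" for w
    using c by (simp add: q_def)
  have nonexp: "norm (p w - p w') \<le> norm (w - w')" for w w'
  proof -
    have "w - w' = (p w - p w') + c *\<^sub>R (q w - q w')"
      using w_eq[of w] w_eq[of w'] by (simp add: algebra_simps)
    then have "(w - w') \<bullet> (p w - p w') = (norm (p w - p w'))\<^sup>2 + c * ((q w - q w') \<bullet> (p w - p w'))"
      by (simp add: inner_add_left power2_norm_eq_inner)
    then have "(norm (p w - p w'))\<^sup>2 \<le> (w - w') \<bullet> (p w - p w')"
      using subdifferential_monotone[OF h q q, of w w'] c by simp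
    also have "\<dots> \<le> norm (w - w') * norm (p w - p w')"
      by (rule norm_cauchy_schwarz)
    finally show ?thesis
      by (cases "p w = p w'") (auto simp: power2_eq_square)
  qed
  define T where "T = (\<lambda>w. z + c *\<^sub>R q w)"
  have "dist (T w) (T w') \<le> 1 / 2 * dist w w'" for w w'
  proof -
    have "dist (T w) (T w') = c * norm (q w - q w')"
      using c by (simp add: T_def dist_norm flip: scaleR_diff_right)
    also have "\<dots> \<le> c * (L * norm (p w - p w'))"
      using c by (intro mult_left_mono smooth_funD[OF smooth q q]) auto
    also have "\<dots> \<le> c * (L * norm (w - w'))"
      using c L by (intro mult_left_mono nonexp) auto
    finally show ?thesis
      using L by (simp add: c_def dist_norm)
  qed
  then have "\<exists>!w. T w = w"
    by (intro banach_fix_type[where c = "1/2"]) auto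
  then obtain w where "T w = w" by blast
  then have "p w = z"
    using w_eq[of w] by (simp add: T_def) (metis add_right_cancel)
  then show ?thesis
    using q by blast
qed

section \<open>Quadratic bounds for smooth functions\<close>

text \<open>Walk from \<open>y\<close> to \<open>z\<close> in \<open>n\<close> equal steps and bound each increment by the subgradient at the
  end of the step, which differs from \<open>g\<close> by at most \<open>L\<close> times the distance walked. This is a Riemann sum
  for the integral of the gradient along the segment, which overshoots the claim by a term of order
  \<open>1 / n\<close>.\<close>

lemma smooth_fun_descent:
  fixes h :: "'a::euclidean_space \<Rightarrow> ereal"
  assumes closed: "closed_fun h" and h: "proper_fun h" and conv: "ereal_convex h"
    and smooth: "smooth_fun (ereal L) h" and L: "0 < L" and g: "g \<in> subdifferential h y"
  shows "h z \<le> h y + ereal (g \<bullet> (z - y) + L / 2 * (norm (z - y))\<^sup>2)"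
proof -
  obtain G where G: "\<And>u. G u \<in> subdifferential h u"
    using smooth_fun_has_subgradient[OF closed h conv smooth L g] by metis
  define H where "H = (\<lambda>u. real_of_ereal (h u))"
  have hH: "h u = ereal (H u)" for u
    using subgradient_finite[OF h G] by (simp add: H_def)
  have sub: "H u + G u \<bullet> (v - u) \<le> H v" for u v
    using subdifferentialD[OF G, of u v] by (simp add: hH)
  define d where "d = z - y"
  have "H z \<le> (H y + g \<bullet> d + L / 2 * (norm d)\<^sup>2) + (L / 2 * (norm d)\<^sup>2) / real n" if n: "0 < n" for n
  proof -
    define t where "t = 1 / real n"
    have t: "0 < t" using n by (simp add: t_def)
    have walk: "H (y + (real i * t) *\<^sub>R d)
        \<le> H y + real i * t * (g \<bullet> d) + L * (norm d)\<^sup>2 * t\<^sup>2 * (real i * (real i + 1) / 2)" for i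
    proof (induction i)
      case 0
      then show ?case by simp
    next
      case (Suc i)
      define u where "u = y + (real i * t) *\<^sub>R d"
      define v where "v = y + (real (Suc i) * t) *\<^sub>R d"
      have "u - v = - (t *\<^sub>R d)"
        by (simp add: u_def v_def algebra_simps)
      then have step: "H v - H u \<le> t * (G v \<bullet> d)"
        using sub[of v u] by simp
      have "(G v - g) \<bullet> d \<le> norm (G v - g) * norm d"
        by (rule norm_cauchy_schwarz)
      also have "\<dots> \<le> (L * norm (v - y)) * norm d"
        by (intro mult_right_mono smooth_funD[OF smooth G g]) auto
      also have "\<dots> = L * (norm d)\<^sup>2 * (real (Suc i) * t)"
        using t by (simp add: v_def power2_eq_square)
      finally have "t * (G v \<bullet> d) \<le> t * (g \<bullet> d + L * (norm d)\<^sup>2 * (real (Suc i) * t))"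
        using t by (intro mult_left_mono) (auto simp: inner_diff_left)
      then have "H v \<le> H u + t * (g \<bullet> d) + L * (norm d)\<^sup>2 * t\<^sup>2 * real (Suc i)"
        using step by (simp add: power2_eq_square algebra_simps)
      then show ?case
        using Suc.IH unfolding u_def[symmetric] v_def[symmetric]
        by (simp add: field_simps)
    qed
    have "real n * t = 1" using n by (simp add: t_def)
    then have "H z \<le> H y + g \<bullet> d + L * (norm d)\<^sup>2 * t\<^sup>2 * (real n * (real n + 1) / 2)"
      using walk[of n] by (simp add: d_def)
    also have "t\<^sup>2 * (real n * (real n + 1) / 2) = 1 / 2 + 1 / 2 / real n"
      using n by (simp add: t_def power2_eq_square field_simps)
    then have "L * (norm d)\<^sup>2 * t\<^sup>2 * (real n * (real n + 1) / 2) = L * (norm d)\<^sup>2 * (1 / 2 + 1 / 2 / real n)"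
      by (simp only: mult.assoc)
    finally show ?thesis
      by (simp add: algebra_simps)
  qed
  then have "H z \<le> H y + g \<bullet> d + L / 2 * (norm d)\<^sup>2"
    by (rule le_if_le_plus_inverse_nat)
  then show ?thesis
    by (simp add: hH d_def add.assoc)
qed

text \<open>The point \<open>z\<close> below minimises the quadratic upper bound of \<open>h\<close> at \<open>y\<close> minus the affine minorant of
  \<open>h\<close> at \<open>x\<close>. That the former lies above the latter at \<open>z\<close> is the claim.\<close>

lemma smooth_fun_excess:
  fixes h :: "'a::euclidean_space \<Rightarrow> ereal"
  assumes closed: "closed_fun h" and h: "proper_fun h" and conv: "ereal_convex h"
    and smooth: "smooth_fun (ereal L) h" and L: "0 < L"
    and gx: "gx \<in> subdifferential h x" and gy: "gy \<in> subdifferential h y"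
  shows "h x + ereal (gx \<bullet> (y - x) + (norm (gy - gx))\<^sup>2 / (2 * L)) \<le> h y"
proof -
  obtain a b where a: "h x = ereal a" and b: "h y = ereal b"
    using subgradient_finite[OF h gx] subgradient_finite[OF h gy] by blast
  define e where "e = gy - gx"
  define z where "z = y - e /\<^sub>R L"
  have "h x + ereal (gx \<bullet> (z - x)) \<le> h y + ereal (gy \<bullet> (z - y) + L / 2 * (norm (z - y))\<^sup>2)"
    using subdifferentialD[OF gx, of z] smooth_fun_descent[OF closed h conv smooth L gy, of z]
    by (rule order_trans)
  then have "a + gx \<bullet> (z - x) \<le> b + gy \<bullet> (z - y) + L / 2 * (norm (z - y))\<^sup>2"
    by (simp add: a b)
  moreover have "z - x = (y - x) + (z - y)"
    by simp
  then have "gx \<bullet> (z - x) = gx \<bullet> (y - x) + gx \<bullet> (z - y)"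
    by (metis inner_add_right)
  moreover have "gy \<bullet> (z - y) - gx \<bullet> (z - y) = e \<bullet> (z - y)"
    by (simp add: e_def inner_diff_left)
  moreover have "e \<bullet> (z - y) = - ((norm e)\<^sup>2 / L)"
    by (simp add: z_def power2_norm_eq_inner divide_inverse)
  moreover have "L / 2 * (norm (z - y))\<^sup>2 = (norm e)\<^sup>2 / (2 * L)"
    using L by (simp add: z_def power_divide power2_eq_square field_simps)
  moreover have "(norm e)\<^sup>2 / L = (norm e)\<^sup>2 / (2 * L) + (norm e)\<^sup>2 / (2 * L)"
    by (simp add: field_simps)
  ultimately have "a + (gx \<bullet> (y - x) + (norm e)\<^sup>2 / (2 * L)) \<le> b"
    by linarith
  then show ?thesis
    by (simp add: a b e_def)
qed

text \<open>Minimise the quadratic upper bound of \<open>f1 - f2\<close> at \<open>x\<close>; its minimiser is \<open>z\<close> below.\<close>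

lemma subgradient_gap_le_optimality_gap:
  fixes f1 f2 :: "'a::euclidean_space \<Rightarrow> ereal"
  assumes f1: "closed_fun f1" "proper_fun f1" "ereal_convex f1" "smooth_fun (ereal L) f1" and L: "0 < L"
    and f2: "proper_fun f2" "strongly_convex \<mu> f2" and \<mu>: "\<mu> < L"
    and lower: "\<And>y. ereal fstar \<le> dc_diff f1 f2 y"
    and g1: "g1 \<in> subdifferential f1 x" and g2: "g2 \<in> subdifferential f2 x"
  shows "(norm (g1 - g2))\<^sup>2 / (2 * (L - \<mu>)) \<le> real_of_ereal (dc_diff f1 f2 x) - fstar"
proof -
  define d where "d = g1 - g2"
  define z where "z = x - d /\<^sub>R (L - \<mu>)"
  define q where "q = (norm d)\<^sup>2 / (L - \<mu>)"
  obtain a b where a: "f1 x = ereal a" and b: "f2 x = ereal b"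
    using subgradient_finite[OF f1(2) g1] subgradient_finite[OF f2(1) g2] by blast
  have up: "f1 z \<le> ereal (a + (g1 \<bullet> (z - x) + L / 2 * (norm (z - x))\<^sup>2))"
    using smooth_fun_descent[OF f1 L g1, of z] by (simp add: a)
  have low: "ereal (b + (g2 \<bullet> (z - x) + \<mu> / 2 * (norm (z - x))\<^sup>2)) \<le> f2 z"
    using strongly_convex_excess[OF f2 g2, of z] by (simp add: b)
  obtain a' where a': "f1 z = ereal a'"
    using up f1(2) by (cases "f1 z") (auto simp: proper_fun_def)
  \<comment> \<open>If \<open>f2 z\<close> were infinite, then \<open>dc_diff f1 f2 z = -\<infinity>\<close>, below every real lower bound.\<close>
  obtain b' where b': "f2 z = ereal b'"
    using low lower[of z] a' by (cases "f2 z") (auto simp: dc_diff_def)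
  have "fstar \<le> a' - b'"
    using lower[of z] by (simp add: dc_diff_def a' b')
  then have "fstar \<le> a - b + (g1 \<bullet> (z - x) - g2 \<bullet> (z - x)) + (L - \<mu>) / 2 * (norm (z - x))\<^sup>2"
    using up low a' b' by (simp add: left_diff_distrib diff_divide_distrib)
  moreover have "g1 \<bullet> (z - x) - g2 \<bullet> (z - x) = d \<bullet> (z - x)"
    by (simp add: d_def inner_diff_left)
  moreover have "d \<bullet> (z - x) = - q"
    by (simp add: q_def z_def power2_norm_eq_inner divide_inverse)
  moreover have "(L - \<mu>) / 2 * (norm (z - x))\<^sup>2 = q / 2"
    using \<mu> by (simp add: q_def z_def power_divide power2_eq_square divide_simps)
  ultimately have "q / 2 \<le> a - b - fstar"
    by linarith
  then show ?thesis
    by (simp add: dc_diff_def a b q_def d_def mult.commute)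
qed

section \<open>Summing the decrease over a run\<close>

lemma telescoping_decrease:
  fixes F :: "nat \<Rightarrow> real"
  assumes "\<And>k. k \<in> {1..N} \<Longrightarrow> C \<le> F k - F (k + 1)"
  shows "real N * C \<le> F 1 - F (N + 1)"
  using assms
proof (induction N)
  case (Suc N)
  then have "real N * C \<le> F 1 - F (N + 1)" and "C \<le> F (N + 1) - F (N + 2)"
    by (auto simp: Suc.prems)
  then show ?case by (simp add: algebra_simps)
qed simp

lemma le_sqrt_if_mult_square_le:
  fixes m c :: real
  assumes "c * m\<^sup>2 \<le> D" "0 < c"
  shows "m \<le> sqrt (D / c)"
  using assms by (intro real_le_rsqrt) (simp add: field_simps)

theorem corollary3p1:
  fixes f1 f2 :: "real ^ 'n \<Rightarrow> ereal"
    and L1 L2 :: ereal and \<mu>1 \<mu>2 fstar :: real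
    and N :: nat and x g1 g2 :: "nat \<Rightarrow> real ^ 'n"
  assumes "0 < L1" and "0 < L2" and "0 \<le> \<mu>1" and "0 \<le> \<mu>2"
    and "ereal \<mu>2 < L1" and "ereal \<mu>1 < L2"
    and "f1 \<in> F_class \<mu>1 L1" and "f2 \<in> F_class \<mu>2 L2"
    and "lower_semicontinuous (dc_diff f1 f2)"
    and "\<And>y. ereal fstar \<le> dc_diff f1 f2 y"
    and "1 \<le> N"
    and "dca_run f1 f2 N x g1 g2"
  shows "(\<forall>l2. L1 = \<infinity> \<and> L2 = ereal l2 \<longrightarrow>
            Min ((\<lambda>k. norm (g1 k - g2 k)) ` {1..N + 1})
              \<le> sqrt (2 * l2\<^sup>2 * (real_of_ereal (dc_diff f1 f2 (x 1)) - fstar)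
                       / (real N * (l2 + \<mu>1))))
       \<and> (\<forall>l1. L2 = \<infinity> \<and> L1 = ereal l1 \<longrightarrow>
            Min ((\<lambda>k. norm (g1 k - g2 k)) ` {1..N + 1})
              \<le> sqrt (2 * l1\<^sup>2 * (l1 - \<mu>2) * (real_of_ereal (dc_diff f1 f2 (x 1)) - fstar)
                       / ((l1\<^sup>2 - \<mu>2\<^sup>2) * real N + l1\<^sup>2)))
       \<and> (\<forall>l1 l2. L1 = ereal l1 \<and> L2 = ereal l2 \<and> \<mu>1 = 0 \<and> \<mu>2 = 0 \<longrightarrow>
            Min ((\<lambda>k. norm (g1 k - g2 k)) ` {1..N + 1})
              \<le> sqrt (2 * l1 * l2 * (real_of_ereal (dc_diff f1 f2 (x 1)) - fstar)
                       / ((l1 + l2) * real N + l2)))"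
proof -
  have f1: "closed_fun f1" "proper_fun f1" "ereal_convex f1" "smooth_fun L1 f1" "strongly_convex \<mu>1 f1"
    and f2: "closed_fun f2" "proper_fun f2" "ereal_convex f2" "smooth_fun L2 f2" "strongly_convex \<mu>2 f2"
    using assms(7,8) by (auto simp: F_class_def)
  note sub = dca_run_subdifferential[OF assms(12) f1(2) f2(2)]
  define F where "F = (\<lambda>k. real_of_ereal (dc_diff f1 f2 (x k)))"
  define d where "d = (\<lambda>k. norm (g1 k - g2 k))"
  define m where "m = Min (d ` {1..N + 1})"
  have m_le: "m \<le> d k" if "k \<in> {1..N + 1}" for k
    using that by (auto simp: m_def)
  have "m \<in> d ` {1..N + 1}"
    unfolding m_def by (intro Min_in) auto
  then have "0 \<le> m"
    by (auto simp: d_def)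
  then have m2_le: "m\<^sup>2 \<le> (d k)\<^sup>2" if "k \<in> {1..N + 1}" for k
    using m_le[OF that] by (intro power_mono)
  have finite: "f1 (x k) = ereal (real_of_ereal (f1 (x k)))" "f2 (x k) = ereal (real_of_ereal (f2 (x k)))"
    if "k \<in> {1..N + 1}" for k
    using subgradient_finite[OF f1(2) sub(1)] subgradient_finite[OF f2(2) sub(2)] that by auto
  have F_eq: "F k = real_of_ereal (f1 (x k)) - real_of_ereal (f2 (x k))" if k: "k \<in> {1..N + 1}" for k
  proof -
    obtain a b where "f1 (x k) = ereal a" "f2 (x k) = ereal b"
      using finite[OF k] by blast
    then show ?thesis by (simp add: F_def dc_diff_def)
  qed
  have F_ge: "fstar \<le> F k" if k: "k \<in> {1..N + 1}" for k
  proof -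
    obtain a b where "f1 (x k) = ereal a" "f2 (x k) = ereal b"
      using finite[OF k] by blast
    then show ?thesis using assms(10)[of "x k"] by (simp add: F_def dc_diff_def)
  qed
  \<comment> \<open>The linear terms of the two subgradient inequalities cancel because \<open>g1 (k + 1) = g2 k\<close>.\<close>
  have decrease: "e1 + e2 \<le> F k - F (k + 1)"
    if k: "k \<in> {1..N}"
      and e1: "f1 (x (k + 1)) + ereal (g1 (k + 1) \<bullet> (x k - x (k + 1)) + e1) \<le> f1 (x k)"
      and e2: "f2 (x k) + ereal (g2 k \<bullet> (x (k + 1) - x k) + e2) \<le> f2 (x (k + 1))" for k e1 e2
  proof -
    have k': "k \<in> {1..N + 1}" "k + 1 \<in> {1..N + 1}"
      using k by auto
    have g: "g1 (k + 1) = g2 k"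
      using assms(12) k by (simp add: dca_run_def)
    obtain a b a' b' where "f1 (x k) = ereal a" "f2 (x k) = ereal b"
      "f1 (x (k + 1)) = ereal a'" "f2 (x (k + 1)) = ereal b'"
      using finite[OF k'(1)] finite[OF k'(2)] by blast
    then show ?thesis
      using e1 e2 unfolding F_eq[OF k'(1)] F_eq[OF k'(2)] g by (simp add: inner_diff_right)
  qed
  have step: "g1 (k + 1) = g2 k" if "k \<in> {1..N}" for k
    using assms(12) that by (simp add: dca_run_def)
  have case1: "m \<le> sqrt (2 * l2\<^sup>2 * (F 1 - fstar) / (real N * (l2 + \<mu>1)))" if l2: "L2 = ereal l2" for l2
  proof -
    have l: "0 < l2" using assms(2) l2 by simp
    have "(l2 + \<mu>1) * m\<^sup>2 / (2 * l2\<^sup>2) \<le> F k - F (k + 1)" if k: "k \<in> {1..N}" for k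
    proof -
      have k': "k \<in> {1..N + 1}" "k + 1 \<in> {1..N + 1}"
        using k by auto
      have d: "d (k + 1) = norm (g2 (k + 1) - g2 k)"
        using step[OF k] by (simp add: d_def norm_minus_commute)
      have "\<mu>1 / 2 * (norm (x k - x (k + 1)))\<^sup>2 + (d (k + 1))\<^sup>2 / (2 * l2) \<le> F k - F (k + 1)"
        using f2(4) unfolding d l2
        by (intro decrease[OF k] strongly_convex_excess[OF f1(2,5)] smooth_fun_excess[OF f2(1-3) _ l]
            sub k')
      \<comment> \<open>Smoothness of \<open>f2\<close> bounds the step length from below, which turns the first excess into a
        multiple of \<open>m\<^sup>2\<close>.\<close>
      moreover have "d (k + 1) \<le> l2 * norm (x (k + 1) - x k)"
        using smooth_funD[OF f2(4)[unfolded l2] sub(2)[OF k'(2)] sub(2)[OF k'(1)]] unfolding d .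
      then have "m \<le> l2 * norm (x k - x (k + 1))"
        using m_le[OF k'(2)] by (simp add: norm_minus_commute)
      then have "m\<^sup>2 \<le> (l2 * norm (x k - x (k + 1)))\<^sup>2"
        using \<open>0 \<le> m\<close> by (rule power_mono)
      then have "\<mu>1 / 2 * (m\<^sup>2 / l2\<^sup>2) \<le> \<mu>1 / 2 * (norm (x k - x (k + 1)))\<^sup>2"
        using l assms(3) by (intro mult_left_mono) (simp_all add: power_mult_distrib field_simps)
      moreover have "m\<^sup>2 / (2 * l2) \<le> (d (k + 1))\<^sup>2 / (2 * l2)"
        using l m2_le[OF k'(2)] by (intro divide_right_mono) auto
      moreover have "(l2 + \<mu>1) * m\<^sup>2 / (2 * l2\<^sup>2) = \<mu>1 / 2 * (m\<^sup>2 / l2\<^sup>2) + m\<^sup>2 / (2 * l2)"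
        using l by (simp add: field_simps power2_eq_square)
      ultimately show ?thesis by linarith
    qed
    then have "real N * ((l2 + \<mu>1) * m\<^sup>2 / (2 * l2\<^sup>2)) \<le> F 1 - F (N + 1)"
      by (rule telescoping_decrease)
    then have "real N * ((l2 + \<mu>1) * m\<^sup>2 / (2 * l2\<^sup>2)) \<le> F 1 - fstar"
      using F_ge[of "N + 1"] by simp
    then have "real N * (l2 + \<mu>1) * m\<^sup>2 \<le> 2 * l2\<^sup>2 * (F 1 - fstar)"
      using l by (simp add: field_simps)
    then show ?thesis
      using l assms(3,11) by (intro le_sqrt_if_mult_square_le) auto
  qed
  have last: "m\<^sup>2 / (2 * (l1 - \<mu>2)) \<le> F (N + 1) - fstar" if l1: "L1 = ereal l1" for l1
  proof -
    have "0 < l1" "\<mu>2 < l1" using assms(1,5) l1 by auto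
    then have "(d (N + 1))\<^sup>2 / (2 * (l1 - \<mu>2)) \<le> F (N + 1) - fstar"
      unfolding d_def F_def using f1(4) l1
      by (intro subgradient_gap_le_optimality_gap[OF f1(1-3) _ _ f2(2,5) _ assms(10)] sub) auto
    moreover have "m\<^sup>2 / (2 * (l1 - \<mu>2)) \<le> (d (N + 1))\<^sup>2 / (2 * (l1 - \<mu>2))"
      using \<open>\<mu>2 < l1\<close> m2_le[of "N + 1"] by (intro divide_right_mono) auto
    ultimately show ?thesis by linarith
  qed
  have case2: "m \<le> sqrt (2 * l1\<^sup>2 * (l1 - \<mu>2) * (F 1 - fstar) / ((l1\<^sup>2 - \<mu>2\<^sup>2) * real N + l1\<^sup>2))"
    if l1: "L1 = ereal l1" for l1
  proof -
    have l: "0 < l1" "\<mu>2 < l1" using assms(1,5) l1 by auto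
    have "(l1 + \<mu>2) * m\<^sup>2 / (2 * l1\<^sup>2) \<le> F k - F (k + 1)" if k: "k \<in> {1..N}" for k
    proof -
      have k': "k \<in> {1..N + 1}" "k + 1 \<in> {1..N + 1}"
        using k by auto
      have d: "d k = norm (g1 k - g1 (k + 1))"
        using step[OF k] by (simp add: d_def)
      have "(d k)\<^sup>2 / (2 * l1) + \<mu>2 / 2 * (norm (x (k + 1) - x k))\<^sup>2 \<le> F k - F (k + 1)"
        using f1(4) unfolding d l1
        by (intro decrease[OF k] strongly_convex_excess[OF f2(2,5)] smooth_fun_excess[OF f1(1-3) _ l(1)]
            sub k')
      moreover have "d k \<le> l1 * norm (x k - x (k + 1))"
        using smooth_funD[OF f1(4)[unfolded l1] sub(1)[OF k'(1)] sub(1)[OF k'(2)]] unfolding d .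
      then have "m \<le> l1 * norm (x (k + 1) - x k)"
        using m_le[OF k'(1)] by (simp add: norm_minus_commute)
      then have "m\<^sup>2 \<le> (l1 * norm (x (k + 1) - x k))\<^sup>2"
        using \<open>0 \<le> m\<close> by (rule power_mono)
      then have "\<mu>2 / 2 * (m\<^sup>2 / l1\<^sup>2) \<le> \<mu>2 / 2 * (norm (x (k + 1) - x k))\<^sup>2"
        using l assms(4) by (intro mult_left_mono) (simp_all add: power_mult_distrib field_simps)
      moreover have "m\<^sup>2 / (2 * l1) \<le> (d k)\<^sup>2 / (2 * l1)"
        using l m2_le[OF k'(1)] by (intro divide_right_mono) auto
      moreover have "(l1 + \<mu>2) * m\<^sup>2 / (2 * l1\<^sup>2) = \<mu>2 / 2 * (m\<^sup>2 / l1\<^sup>2) + m\<^sup>2 / (2 * l1)"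
        using l by (simp add: field_simps power2_eq_square)
      ultimately show ?thesis by linarith
    qed
    then have "real N * ((l1 + \<mu>2) * m\<^sup>2 / (2 * l1\<^sup>2)) \<le> F 1 - F (N + 1)"
      by (rule telescoping_decrease)
    then have "real N * ((l1 + \<mu>2) * m\<^sup>2 / (2 * l1\<^sup>2)) + m\<^sup>2 / (2 * (l1 - \<mu>2)) \<le> F 1 - fstar"
      using last[OF l1] by simp
    then have "2 * l1\<^sup>2 * (l1 - \<mu>2) * (real N * ((l1 + \<mu>2) * m\<^sup>2 / (2 * l1\<^sup>2)) + m\<^sup>2 / (2 * (l1 - \<mu>2)))
        \<le> 2 * l1\<^sup>2 * (l1 - \<mu>2) * (F 1 - fstar)"
      using l by (intro mult_left_mono) auto
    also have "2 * l1\<^sup>2 * (l1 - \<mu>2) * (real N * ((l1 + \<mu>2) * m\<^sup>2 / (2 * l1\<^sup>2)) + m\<^sup>2 / (2 * (l1 - \<mu>2)))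
        = ((l1\<^sup>2 - \<mu>2\<^sup>2) * real N + l1\<^sup>2) * m\<^sup>2"
      using l by (simp add: divide_simps) (simp add: power2_eq_square algebra_simps)
    finally show ?thesis
      using l assms(4) by (intro le_sqrt_if_mult_square_le add_nonneg_pos) (auto simp: power_mono)
  qed
  have case3: "m \<le> sqrt (2 * l1 * l2 * (F 1 - fstar) / ((l1 + l2) * real N + l2))"
    if l1: "L1 = ereal l1" and l2: "L2 = ereal l2" and \<mu>: "\<mu>2 = 0" for l1 l2
  proof -
    have l: "0 < l1" "0 < l2" using assms(1,2) l1 l2 by auto
    have "m\<^sup>2 / (2 * l1) + m\<^sup>2 / (2 * l2) \<le> F k - F (k + 1)" if k: "k \<in> {1..N}" for k
    proof -
      have k': "k \<in> {1..N + 1}" "k + 1 \<in> {1..N + 1}"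
        using k by auto
      have d: "d k = norm (g1 k - g1 (k + 1))" "d (k + 1) = norm (g2 (k + 1) - g2 k)"
        using step[OF k] by (simp_all add: d_def norm_minus_commute)
      have "(d k)\<^sup>2 / (2 * l1) + (d (k + 1))\<^sup>2 / (2 * l2) \<le> F k - F (k + 1)"
        using f1(4) f2(4) unfolding d l1 l2
        by (intro decrease[OF k] smooth_fun_excess[OF f1(1-3) _ l(1)] smooth_fun_excess[OF f2(1-3) _ l(2)]
            sub k')
      moreover have "m\<^sup>2 / (2 * l1) \<le> (d k)\<^sup>2 / (2 * l1)" "m\<^sup>2 / (2 * l2) \<le> (d (k + 1))\<^sup>2 / (2 * l2)"
        using l m2_le[OF k'(1)] m2_le[OF k'(2)] by (intro divide_right_mono; simp)+
      ultimately show ?thesis by linarith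
    qed
    then have "real N * (m\<^sup>2 / (2 * l1) + m\<^sup>2 / (2 * l2)) \<le> F 1 - F (N + 1)"
      by (rule telescoping_decrease)
    then have "real N * (m\<^sup>2 / (2 * l1) + m\<^sup>2 / (2 * l2)) + m\<^sup>2 / (2 * l1) \<le> F 1 - fstar"
      using last[OF l1] \<mu> by simp
    then have "2 * l1 * l2 * (real N * (m\<^sup>2 / (2 * l1) + m\<^sup>2 / (2 * l2)) + m\<^sup>2 / (2 * l1))
        \<le> 2 * l1 * l2 * (F 1 - fstar)"
      using l by (intro mult_left_mono) auto
    also have "2 * l1 * l2 * (real N * (m\<^sup>2 / (2 * l1) + m\<^sup>2 / (2 * l2)) + m\<^sup>2 / (2 * l1))
        = ((l1 + l2) * real N + l2) * m\<^sup>2"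
      using l by (simp add: field_simps)
    finally show ?thesis
      using l by (intro le_sqrt_if_mult_square_le add_nonneg_pos) auto
  qed
  show ?thesis
    using case1 case2 case3 unfolding m_def d_def F_def by blast
qed

end
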